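(* For every finitely generated group $G$ there exist a Riemann surface $S$ (non-compact if $G$ is not finite) and a non-constant meromorphic map $\beta:S\to\widehat{\mathbb C}$ branched over at most three values such that $G$ is isomorphic to the full group of conformal automorphisms of $\beta$, i.e. to the group of all conformal automorphisms $\phi$ of $S$ satisfying $\beta=\beta\circ\phi$.
   Context: Riemann surfaces are connected. $\widehat{\mathbb C}$ denotes the Riemann sphere. The group of (conformal) automorphisms of a non-constant meromorphic map $\beta:S\to\widehat{\mathbb C}$ consists of those conformal automorphisms $\phi$ of $S$ with $\beta=\beta\circ\phi$. *)

theory Defs
  imports "HOL-Analysis.Analysis" "HOL-Algebra.Bij" "HOL-Algebra.Generated_Groups"
begin

section \<open>Riemann surfaces and holomorphic maps\<close>

type_synonym 'a chart = "'a set \<times> ('a \<Rightarrow> complex)"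

definition complex_chart :: "'a topology \<Rightarrow> 'a chart \<Rightarrow> bool" where
  "complex_chart X = (\<lambda>(U, \<phi>). openin X U \<and> open (\<phi> ` U) \<and>
     homeomorphic_map (subtopology X U) (top_of_set (\<phi> ` U)) \<phi>)"

text \<open>Second countability is not required: by Rado's theorem it is automatic.\<close>

locale riemann_surface =
  fixes X :: "'a topology" and \<A> :: "'a chart set"
  assumes nonempty: "topspace X \<noteq> {}"
    and connected: "connected_space X"
    and Hausdorff: "Hausdorff_space X"
    and charts: "\<And>c. c \<in> \<A> \<Longrightarrow> complex_chart X c"
    and cover: "\<Union> (fst ` \<A>) = topspace X"
    and compatible: "\<And>U \<phi> V \<psi>. (U, \<phi>) \<in> \<A> \<Longrightarrow> (V, \<psi>) \<in> \<A> \<Longrightarrow>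
      (\<psi> \<circ> inv_into U \<phi>) holomorphic_on \<phi> ` (U \<inter> V)"

definition holomorphic_map ::
  "'a topology \<Rightarrow> 'a chart set \<Rightarrow> 'b topology \<Rightarrow> 'b chart set \<Rightarrow> ('a \<Rightarrow> 'b) \<Rightarrow> bool" where
  "holomorphic_map X \<A> Y \<B> f \<longleftrightarrow> continuous_map X Y f \<and>
     (\<forall>(U, \<phi>) \<in> \<A>. \<forall>(V, \<psi>) \<in> \<B>.
        (\<psi> \<circ> f \<circ> inv_into U \<phi>) holomorphic_on \<phi> ` (U \<inter> f -` V))"


section \<open>The Riemann sphere and meromorphic maps\<close>

text \<open>
  The point at infinity is \<^term>\<open>None\<close>. The second chart is \<open>1/z\<close>, with value \<open>0\<close> at infinity,
  on the complement of the origin.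
\<close>

definition riemann_sphere :: "complex option topology" where
  "riemann_sphere = Alexandroff_compactification euclidean"

definition sphere_charts :: "complex option chart set" where
  "sphere_charts =
     {(range Some, the),
      (UNIV - {Some 0}, \<lambda>w. case w of None \<Rightarrow> 0 | Some z \<Rightarrow> 1 / z)}"

text \<open>Poles are the points sent to \<^term>\<open>None\<close>.\<close>

definition meromorphic_map ::
  "'a topology \<Rightarrow> 'a chart set \<Rightarrow> ('a \<Rightarrow> complex option) \<Rightarrow> bool" where
  "meromorphic_map X \<A> \<beta> \<longleftrightarrow> holomorphic_map X \<A> riemann_sphere sphere_charts \<beta>"


section \<open>Branching\<close>

text \<open>
  The library notion \<^const>\<open>covering_space\<close> applies only to subsets of topological type classes;
  here is evenly-coveredness for abstract topologies.
\<close>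

definition evenly_covered :: "'a topology \<Rightarrow> 'b topology \<Rightarrow> ('a \<Rightarrow> 'b) \<Rightarrow> 'b set \<Rightarrow> bool" where
  "evenly_covered X Y p V \<longleftrightarrow> openin Y V \<and>
     (\<exists>\<U>. \<Union>\<U> = {x \<in> topspace X. p x \<in> V} \<and>
          (\<forall>U\<in>\<U>. openin X U) \<and> pairwise disjnt \<U> \<and>
          (\<forall>U\<in>\<U>. homeomorphic_map (subtopology X U) (subtopology Y V) p))"

text \<open>
  A map is branched over exactly those values near which it is not an unramified covering. This
  includes all critical values and, on non-compact surfaces, also all asymptotic values. Away
  from its set of branch values a map is a covering map.
\<close>

definition branch_values :: "'a topology \<Rightarrow> 'b topology \<Rightarrow> ('a \<Rightarrow> 'b) \<Rightarrow> 'b set" where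
  "branch_values X Y p =
     {w \<in> topspace Y. \<nexists>V. w \<in> V \<and> evenly_covered X Y p V}"


section \<open>Automorphism groups\<close>

definition conformal_automorphisms :: "'a topology \<Rightarrow> 'a chart set \<Rightarrow> ('a \<Rightarrow> 'a) set" where
  "conformal_automorphisms X \<A> =
     {\<phi> \<in> Bij (topspace X). holomorphic_map X \<A> X \<A> \<phi> \<and>
        holomorphic_map X \<A> X \<A> (inv_into (topspace X) \<phi>)}"

definition map_automorphism_group ::
  "'a topology \<Rightarrow> 'a chart set \<Rightarrow> ('a \<Rightarrow> 'b) \<Rightarrow> ('a \<Rightarrow> 'a) monoid" where
  "map_automorphism_group X \<A> \<beta> = BijGroup (topspace X)
     \<lparr>carrier := {\<phi> \<in> conformal_automorphisms X \<A>. \<forall>x\<in>topspace X. \<beta> x = \<beta> (\<phi> x)}\<rparr>"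


section \<open>Finitely generated groups\<close>

definition finitely_generated_group :: "('g, 'r) monoid_scheme \<Rightarrow> bool" where
  "finitely_generated_group G \<longleftrightarrow> group G \<and>
     (\<exists>A. finite A \<and> A \<subseteq> carrier G \<and> generate G A = carrier G)"

end

theory Submission
  imports Defs
begin

text \<open>
  A map that is an unramified covering of \<open>\<complex> \<setminus> {0, 1}\<close> has at most the branch values \<open>0\<close>, \<open>1\<close> and
  \<open>\<infinity>\<close>, so it suffices to find a connected covering of the twice punctured plane whose group of deck
  transformations is \<open>G\<close>. Such a covering is the same thing as a transitive action of the free
  group of rank two, that is, a set \<open>\<Omega>\<close> of sheets with two permutations \<open>a\<close> and \<open>b\<close>, and its deck
  transformations are the permutations of \<open>\<Omega>\<close> that commute with both. The proof therefore has an
  algebraic and a geometric half.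

  Algebra (\<open>permutations_with_centralizer\<close>): for a finite generating set \<open>A\<close> and \<open>K = insert 1 A\<close> take
  \<open>\<Omega> = G \<times> K\<close>, let \<open>a\<close> permute \<open>K\<close> cyclically and leave the first coordinate alone, and let
  \<open>b (g, k) = (g k, k)\<close>. Left translations commute with both. Conversely, the fixed points of \<open>b\<close> are
  exactly the pairs \<open>(g, 1)\<close>, so a commuting permutation sends \<open>(1, 1)\<close> to some \<open>(g, 1)\<close>; it agrees
  there with the left translation by \<open>g\<close>, hence everywhere by transitivity.

  Geometry (locale \<open>slit_gluing\<close>): the covering is built by hand, without universal covers. Over each
  sheet lie an upper and a lower half-plane, and these are joined across the three components
  \<open>(-\<infinity>, 0)\<close>, \<open>(0, 1)\<close>, \<open>(1, \<infinity>)\<close> of the punctured real axis: across \<open>(0, 1)\<close> within the sheet, across the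
  other two according to \<open>a\<close> and \<open>b\<close>. The plane slit along two of the three components is simply
  connected and evenly covered. Deck transformations are read off by \<open>automorphism_is_deck\<close> and
  constructed by \<open>deck_in_automorphisms\<close>.

  For finite \<open>G\<close>, too, the surface so obtained is non-compact, with punctures over the branch values.
\<close>

section \<open>Gluing slit planes\<close>

text \<open>
  The planes \<open>slit_plane i\<close> are the complex plane cut along the real axis except for the open interval
  \<open>gap i\<close>. The copy of the upper half-plane on sheet \<open>w\<close> is joined through \<open>gap i\<close> to the copy of the
  lower half-plane on sheet \<open>cross i w\<close>; the index \<open>i0\<close> with trivial crossing fixes the numbering of the
  lower half-planes. The point over \<open>z\<close> on sheet \<open>w\<close> is named \<open>pt z w\<close> in an arbitrary type, so that the
  surface can be realized inside a prescribed one.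
\<close>

locale slit_gluing =
  fixes I :: "'i set" and i0 :: 'i and gap :: "'i \<Rightarrow> real set"
    and \<Omega> :: "'w set" and cross :: "'i \<Rightarrow> 'w \<Rightarrow> 'w" and pt :: "complex \<Rightarrow> 'w \<Rightarrow> 'a"
  assumes i0: "i0 \<in> I" and cross_i0: "\<And>w. w \<in> \<Omega> \<Longrightarrow> cross i0 w = w"
    and open_gap: "\<And>i. i \<in> I \<Longrightarrow> open (gap i)"
    and convex_gap: "\<And>i. i \<in> I \<Longrightarrow> convex (gap i)"
    and nonempty_gap: "\<And>i. i \<in> I \<Longrightarrow> gap i \<noteq> {}"
    and disjoint_gap: "\<And>i j t. i \<in> I \<Longrightarrow> j \<in> I \<Longrightarrow> t \<in> gap i \<Longrightarrow> t \<in> gap j \<Longrightarrow> i = j"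
    and sheets: "\<Omega> \<noteq> {}"
    and bij_cross: "\<And>i. i \<in> I \<Longrightarrow> bij_betw (cross i) \<Omega> \<Omega>"
    and transitive: "\<And>P. P \<subseteq> \<Omega> \<Longrightarrow> P \<noteq> {} \<Longrightarrow> (\<And>i w. i \<in> I \<Longrightarrow> w \<in> \<Omega> \<Longrightarrow> cross i w \<in> P \<longleftrightarrow> w \<in> P) \<Longrightarrow> P = \<Omega>"
    and pt_inject: "\<And>z w z' w'. w \<in> \<Omega> \<Longrightarrow> w' \<in> \<Omega> \<Longrightarrow> pt z w = pt z' w' \<Longrightarrow> z = z' \<and> w = w'"
begin

definition slit_plane :: "'i \<Rightarrow> complex set" where
  "slit_plane i = {z. Im z = 0 \<longrightarrow> Re z \<in> gap i}"

definition base :: "complex set" where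
  "base = (\<Union>i\<in>I. slit_plane i)"

definition points :: "'a set" where
  "points = {pt z w | z w. z \<in> base \<and> w \<in> \<Omega>}"

definition proj :: "'a \<Rightarrow> complex" where
  "proj x = (THE z. \<exists>w\<in>\<Omega>. x = pt z w)"

text \<open>
  Real points belong to the same sheet as the upper half-plane; hence only the lower half-plane
  changes sheets. The function \<open>sec i w\<close> is then the section over \<open>slit_plane i\<close> that starts on sheet
  \<open>w\<close> in the upper half-plane, and the topology is the finest one that makes all these sections
  continuous.
\<close>

definition lift :: "'i \<Rightarrow> 'w \<Rightarrow> complex \<Rightarrow> 'w" where
  "lift i w z = (if Im z < 0 then cross i w else w)"

definition sec :: "'i \<Rightarrow> 'w \<Rightarrow> complex \<Rightarrow> 'a" where
  "sec i w z = pt z (lift i w z)"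

definition surface :: "'a topology" where
  "surface = topology (\<lambda>W. W \<subseteq> points \<and> (\<forall>i\<in>I. \<forall>w\<in>\<Omega>. open {z \<in> slit_plane i. sec i w z \<in> W}))"

definition leaf :: "'i \<Rightarrow> 'w \<Rightarrow> 'a set" where
  "leaf i w = sec i w ` slit_plane i"

definition atlas :: "'a chart set" where
  "atlas = {(leaf i w, proj) | i w. i \<in> I \<and> w \<in> \<Omega>}"

section \<open>Slit planes and sections\<close>

lemma slit_plane_alt: "slit_plane i = {z. Im z > 0} \<union> {z. Im z < 0} \<union> Re -` gap i"
  by (auto simp: slit_plane_def)

lemma open_slit_plane: "i \<in> I \<Longrightarrow> open (slit_plane i)"
  unfolding slit_plane_alt
  by (intro open_Un open_halfspace_Im_gt open_halfspace_Im_lt open_vimage open_gap continuous_intros)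

text \<open>
  The slit plane is starlike about any point of its gap: a segment from there to a non-real point
  meets the real axis only at its start.
\<close>

lemma connected_slit_plane:
  assumes "i \<in> I" shows "connected (slit_plane i)"
proof -
  obtain t where t: "t \<in> gap i" using nonempty_gap[OF assms] by auto
  have "closed_segment (of_real t) z \<subseteq> slit_plane i" if z: "z \<in> slit_plane i" for z
  proof
    fix y assume "y \<in> closed_segment (of_real t) z"
    then obtain u where u: "0 \<le> u" "u \<le> 1" and y: "y = (1 - u) *\<^sub>R of_real t + u *\<^sub>R z"
      by (auto simp: closed_segment_def)
    show "y \<in> slit_plane i"
    proof (cases "Im z = 0")
      case True
      then have "Re z \<in> gap i" using z by (simp add: slit_plane_def)
      then have "(1 - u) *\<^sub>R t + u *\<^sub>R Re z \<in> gap i"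
        using convexD_alt[OF convex_gap[OF assms] t] u by simp
      then show ?thesis by (simp add: y slit_plane_def)
    next
      case False
      then show ?thesis using t by (auto simp: y slit_plane_def)
    qed
  qed
  moreover have "of_real t \<in> slit_plane i" using t by (simp add: slit_plane_def)
  ultimately have "starlike (slit_plane i)" by (auto simp: starlike_def)
  then show ?thesis by (rule starlike_imp_connected)
qed

lemma off_axis_in_slit_plane: "Im z \<noteq> 0 \<Longrightarrow> z \<in> slit_plane i"
  by (simp add: slit_plane_def)

lemma slit_plane_Int_off_axis: "\<lbrakk>i \<in> I; j \<in> I; i \<noteq> j; z \<in> slit_plane i; z \<in> slit_plane j\<rbrakk> \<Longrightarrow> Im z \<noteq> 0"
  using disjoint_gap by (auto simp: slit_plane_def)

lemma slit_plane_subset_base: "i \<in> I \<Longrightarrow> slit_plane i \<subseteq> base"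
  by (auto simp: base_def)

lemma cross_in: "\<lbrakk>i \<in> I; w \<in> \<Omega>\<rbrakk> \<Longrightarrow> cross i w \<in> \<Omega>"
  using bij_cross bij_betw_apply by metis

lemma cross_inject: "\<lbrakk>i \<in> I; w \<in> \<Omega>; w' \<in> \<Omega>; cross i w = cross i w'\<rbrakk> \<Longrightarrow> w = w'"
  using bij_cross by (meson bij_betw_imp_inj_on inj_onD)

lemma lift_in: "\<lbrakk>i \<in> I; w \<in> \<Omega>\<rbrakk> \<Longrightarrow> lift i w z \<in> \<Omega>"
  by (simp add: lift_def cross_in)

lemma lift_inject: "\<lbrakk>i \<in> I; w \<in> \<Omega>; w' \<in> \<Omega>; lift i w z = lift i w' z\<rbrakk> \<Longrightarrow> w = w'"
  by (auto simp: lift_def cross_inject split: if_splits)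

lemma lift_surj:
  assumes "i \<in> I" "w \<in> \<Omega>" obtains w' where "w' \<in> \<Omega>" "lift i w' z = w"
proof (cases "Im z < 0")
  case True
  then show ?thesis using that assms bij_cross[OF assms(1)]
    by (metis bij_betw_iff_bijections lift_def)
next
  case False
  then show ?thesis using that assms by (simp add: lift_def)
qed

lemma proj_pt [simp]: "w \<in> \<Omega> \<Longrightarrow> proj (pt z w) = z"
  unfolding proj_def using pt_inject by blast

lemma proj_sec [simp]: "\<lbrakk>i \<in> I; w \<in> \<Omega>\<rbrakk> \<Longrightarrow> proj (sec i w z) = z"
  by (simp add: sec_def lift_in)

lemma sec_inject: "\<lbrakk>i \<in> I; w \<in> \<Omega>; w' \<in> \<Omega>; sec i w z = sec i w' z'\<rbrakk> \<Longrightarrow> w = w' \<and> z = z'"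
  by (metis lift_in lift_inject proj_sec pt_inject sec_def)

lemma sec_in_points: "\<lbrakk>i \<in> I; w \<in> \<Omega>; z \<in> slit_plane i\<rbrakk> \<Longrightarrow> sec i w z \<in> points"
  using slit_plane_subset_base lift_in by (fastforce simp: sec_def points_def)

lemma pt_eq_sec:
  assumes "i \<in> I" "w \<in> \<Omega>" obtains w' where "w' \<in> \<Omega>" "pt z w = sec i w' z"
  using lift_surj[OF assms] by (metis sec_def)

lemma points_cases:
  assumes "x \<in> points" "proj x \<in> slit_plane i" "i \<in> I"
  obtains w where "w \<in> \<Omega>" "x = sec i w (proj x)" "x \<in> leaf i w"
proof -
  obtain z w where x: "x = pt z w" "w \<in> \<Omega>" using assms(1) by (auto simp: points_def)
  with pt_eq_sec[OF assms(3), of w z] show ?thesis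
    by (metis assms(2) imageI leaf_def proj_pt that)
qed

lemma proj_in_base: "x \<in> points \<Longrightarrow> proj x \<in> base"
  by (auto simp: points_def)

section \<open>The topology\<close>

lemma openin_surface:
  "openin surface W \<longleftrightarrow> W \<subseteq> points \<and> (\<forall>i\<in>I. \<forall>w\<in>\<Omega>. open {z \<in> slit_plane i. sec i w z \<in> W})"
proof -
  have "istopology (\<lambda>W. W \<subseteq> points \<and> (\<forall>i\<in>I. \<forall>w\<in>\<Omega>. open {z \<in> slit_plane i. sec i w z \<in> W}))"
    unfolding istopology_def
  proof (intro conjI allI impI ballI)
    fix S T i w
    assume *: "S \<subseteq> points \<and> (\<forall>i\<in>I. \<forall>w\<in>\<Omega>. open {z \<in> slit_plane i. sec i w z \<in> S})"
        "T \<subseteq> points \<and> (\<forall>i\<in>I. \<forall>w\<in>\<Omega>. open {z \<in> slit_plane i. sec i w z \<in> T})"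
      and "i \<in> I" "w \<in> \<Omega>"
    have "{z \<in> slit_plane i. sec i w z \<in> S \<inter> T} = {z \<in> slit_plane i. sec i w z \<in> S} \<inter> {z \<in> slit_plane i. sec i w z \<in> T}" by auto
    then show "open {z \<in> slit_plane i. sec i w z \<in> S \<inter> T}" using * \<open>i \<in> I\<close> \<open>w \<in> \<Omega>\<close> by (simp add: open_Int)
  next
    fix \<K> i w
    assume *: "\<forall>K\<in>\<K>. K \<subseteq> points \<and> (\<forall>i\<in>I. \<forall>w\<in>\<Omega>. open {z \<in> slit_plane i. sec i w z \<in> K})"
      and "i \<in> I" "w \<in> \<Omega>"
    have "{z \<in> slit_plane i. sec i w z \<in> \<Union>\<K>} = (\<Union>K\<in>\<K>. {z \<in> slit_plane i. sec i w z \<in> K})" by auto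
    then show "open {z \<in> slit_plane i. sec i w z \<in> \<Union>\<K>}" using * \<open>i \<in> I\<close> \<open>w \<in> \<Omega>\<close> by auto
  qed auto
  then show ?thesis by (simp add: surface_def)
qed

lemma topspace_surface [simp]: "topspace surface = points"
proof -
  have "openin surface points"
    unfolding openin_surface using sec_in_points open_slit_plane by (simp cong: conj_cong)
  then show ?thesis
    by (meson openin_surface openin_subset openin_topspace subset_antisym)
qed

lemma continuous_map_proj: "continuous_map surface euclidean proj"
proof -
  have "openin surface {x \<in> points. proj x \<in> V}" if "open V" for V
  proof -
    have "{z \<in> slit_plane i. sec i w z \<in> points \<and> proj (sec i w z) \<in> V} = slit_plane i \<inter> V" if "i \<in> I" "w \<in> \<Omega>" for i w
      using that sec_in_points by auto
    then show ?thesis using that open_slit_plane by (auto simp: openin_surface open_Int)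
  qed
  then show ?thesis by (simp add: continuous_map_def)
qed

lemma continuous_map_sec:
  assumes "i \<in> I" "w \<in> \<Omega>" shows "continuous_map (top_of_set (slit_plane i)) surface (sec i w)"
proof -
  have "openin (top_of_set (slit_plane i)) {z \<in> slit_plane i. sec i w z \<in> W}" if "openin surface W" for W
    using that assms open_slit_plane[of i] by (auto simp: openin_surface openin_open_eq)
  then show ?thesis using assms sec_in_points by (auto simp: continuous_map_def)
qed

text \<open>
  In coordinates this is the compatibility of the sections: two of them over different slit planes
  overlap only off the real axis, and on each half-plane the condition to lie on the same sheet does
  not depend on the point.
\<close>

lemma openin_leaf:
  assumes "i \<in> I" "w \<in> \<Omega>" shows "openin surface (leaf i w)"
  unfolding openin_surface
proof (intro conjI ballI)
  show "leaf i w \<subseteq> points" using assms sec_in_points by (auto simp: leaf_def)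
  fix j v assume j: "j \<in> I" "v \<in> \<Omega>"
  have mem: "sec j v z \<in> leaf i w \<longleftrightarrow> z \<in> slit_plane i \<and> lift j v z = lift i w z" for z
  proof
    assume "sec j v z \<in> leaf i w"
    then obtain z' where z': "z' \<in> slit_plane i" "sec j v z = sec i w z'" by (auto simp: leaf_def)
    then show "z \<in> slit_plane i \<and> lift j v z = lift i w z"
      using pt_inject[OF lift_in lift_in] assms j by (metis sec_def)
  qed (auto simp: leaf_def sec_def)
  show "open {z \<in> slit_plane j. sec j v z \<in> leaf i w}"
  proof (cases "i = j")
    case True
    then have "{z \<in> slit_plane j. sec j v z \<in> leaf i w} = (if v = w then slit_plane i else {})"
      unfolding mem using lift_inject assms j by auto
    then show ?thesis using open_slit_plane assms by simp
  next
    case False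
    have "z \<in> slit_plane j \<and> z \<in> slit_plane i \<and> lift j v z = lift i w z \<longleftrightarrow>
        Im z > 0 \<and> v = w \<or> Im z < 0 \<and> cross j v = cross i w" for z
    proof (cases "Im z = 0")
      case True
      then show ?thesis using slit_plane_Int_off_axis[OF assms(1) j(1) False, of z] by auto
    next
      case False
      then show ?thesis by (simp add: off_axis_in_slit_plane lift_def)
    qed
    then have "{z \<in> slit_plane j. sec j v z \<in> leaf i w} =
        {z. Im z > 0 \<and> v = w} \<union> {z. Im z < 0 \<and> cross j v = cross i w}"
      unfolding mem by blast
    moreover have "open {z. Im z > 0 \<and> v = w}" "open {z. Im z < 0 \<and> cross j v = cross i w}"
      using open_halfspace_Im_gt[of 0] open_halfspace_Im_lt[of 0] by (cases "v = w"; cases "cross j v = cross i w"; simp)+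
    ultimately show ?thesis by (simp add: open_Un)
  qed
qed

lemma leaf_subset: "\<lbrakk>i \<in> I; w \<in> \<Omega>\<rbrakk> \<Longrightarrow> leaf i w \<subseteq> points"
  using openin_leaf openin_surface by blast

lemma proj_leaf: "\<lbrakk>i \<in> I; w \<in> \<Omega>\<rbrakk> \<Longrightarrow> proj ` leaf i w = slit_plane i"
  by (force simp: leaf_def image_image)

lemma leaf_disjoint: "\<lbrakk>i \<in> I; v \<in> \<Omega>; w \<in> \<Omega>; v \<noteq> w\<rbrakk> \<Longrightarrow> leaf i v \<inter> leaf i w = {}"
  using sec_inject by (auto simp: leaf_def)

lemma homeomorphic_map_leaf:
  assumes "i \<in> I" "w \<in> \<Omega>"
  shows "homeomorphic_map (subtopology surface (leaf i w)) (top_of_set (slit_plane i)) proj"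
proof (rule homeomorphic_maps_imp_map)
  show "homeomorphic_maps (subtopology surface (leaf i w)) (top_of_set (slit_plane i)) proj (sec i w)"
    unfolding homeomorphic_maps_def
  proof (intro conjI ballI)
    show "continuous_map (subtopology surface (leaf i w)) (top_of_set (slit_plane i)) proj"
      using continuous_map_proj proj_leaf[OF assms]
      by (auto simp: continuous_map_in_subtopology continuous_map_from_subtopology)
    show "continuous_map (top_of_set (slit_plane i)) (subtopology surface (leaf i w)) (sec i w)"
      using continuous_map_sec[OF assms] by (auto simp: continuous_map_in_subtopology leaf_def)
  qed (use assms in \<open>auto simp: leaf_def\<close>)
qed

lemma connectedin_leaf: "\<lbrakk>i \<in> I; w \<in> \<Omega>\<rbrakk> \<Longrightarrow> connectedin surface (leaf i w)"
  unfolding leaf_def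
  by (rule connectedin_continuous_map_image[OF continuous_map_sec])
    (auto simp: connectedin_subtopology connected_slit_plane)

text \<open>
  A clopen set contains or misses each leaf as a whole. Since a leaf over \<open>slit_plane i\<close> contains the
  upper half-plane of sheet \<open>w\<close> and the lower half-plane of sheet \<open>cross i w\<close>, the set of sheets met is
  invariant under all crossings.
\<close>

lemma connected_space_surface: "connected_space surface"
  unfolding connected_space_clopen_in
proof (intro allI impI, elim conjE)
  fix T assume T: "openin surface T" "closedin surface T"
  have dich: "leaf i w \<inter> T \<noteq> {} \<longleftrightarrow> leaf i w \<subseteq> T" if "i \<in> I" "w \<in> \<Omega>" for i w
  proof -
    have "leaf i w \<noteq> {}" using off_axis_in_slit_plane[of \<i> i] by (auto simp: leaf_def)
    moreover have "leaf i w \<inter> T = {} \<or> leaf i w \<subseteq> T"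
      using connectedin_leaf[OF that] T by (metis connectedin_clopen_cases disjnt_def)
    ultimately show ?thesis by blast
  qed
  have upper: "leaf i w \<subseteq> T \<longleftrightarrow> pt \<i> w \<in> T" if "i \<in> I" "w \<in> \<Omega>" for i w
  proof -
    have "pt \<i> w \<in> leaf i w"
      unfolding leaf_def using off_axis_in_slit_plane[of \<i> i] by (force simp: sec_def lift_def)
    then show ?thesis using dich[OF that] by blast
  qed
  have lower: "leaf i w \<subseteq> T \<longleftrightarrow> pt (-\<i>) (cross i w) \<in> T" if "i \<in> I" "w \<in> \<Omega>" for i w
  proof -
    have "pt (-\<i>) (cross i w) \<in> leaf i w"
      unfolding leaf_def using off_axis_in_slit_plane[of "-\<i>" i] by (force simp: sec_def lift_def)
    then show ?thesis using dich[OF that] by blast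
  qed
  define P where "P = {w \<in> \<Omega>. pt \<i> w \<in> T}"
  have step: "cross i w \<in> P \<longleftrightarrow> w \<in> P" if "i \<in> I" "w \<in> \<Omega>" for i w
  proof -
    have "w \<in> P \<longleftrightarrow> pt (-\<i>) (cross i w) \<in> T"
      using upper[OF that] lower[OF that] that by (simp add: P_def)
    also have "\<dots> \<longleftrightarrow> leaf i0 (cross i w) \<subseteq> T"
      using lower[OF i0 cross_in[OF that]] cross_i0[OF cross_in[OF that]] by simp
    also have "\<dots> \<longleftrightarrow> cross i w \<in> P"
      using upper[OF i0 cross_in[OF that]] cross_in[OF that] by (simp add: P_def)
    finally show ?thesis by simp
  qed
  show "T = {} \<or> T = topspace surface"
  proof (cases "P = {}")
    case True
    have "x \<notin> T" if x: "x \<in> points" for x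
    proof -
      obtain i where "i \<in> I" "proj x \<in> slit_plane i" using proj_in_base[OF x] by (auto simp: base_def)
      then obtain w where w: "w \<in> \<Omega>" "x \<in> leaf i w" using points_cases[OF x] by blast
      then have "\<not> leaf i w \<subseteq> T" using True upper[OF \<open>i \<in> I\<close>] by (auto simp: P_def)
      then show ?thesis using dich[OF \<open>i \<in> I\<close> w(1)] w(2) by blast
    qed
    then show ?thesis using T openin_surface by blast
  next
    case False
    then have "P = \<Omega>" using transitive[of P] step by (auto simp: P_def)
    have "x \<in> T" if x: "x \<in> points" for x
    proof -
      obtain i where "i \<in> I" "proj x \<in> slit_plane i" using proj_in_base[OF x] by (auto simp: base_def)
      then obtain w where w: "w \<in> \<Omega>" "x \<in> leaf i w" using points_cases[OF x] by blast
      then have "leaf i w \<subseteq> T" using \<open>P = \<Omega>\<close> upper[OF \<open>i \<in> I\<close>] by (auto simp: P_def)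
      then show ?thesis using w(2) by blast
    qed
    then show ?thesis using T openin_surface by auto
  qed
qed

text \<open>
  Points with different projections are separated in the plane; points with the same projection lie in
  disjoint leaves over a common slit plane.
\<close>

lemma Hausdorff_space_surface: "Hausdorff_space surface"
  unfolding Hausdorff_space_def
proof (intro allI impI, elim conjE)
  fix x y assume xy: "x \<in> topspace surface" "y \<in> topspace surface" "x \<noteq> y"
  show "\<exists>U V. openin surface U \<and> openin surface V \<and> x \<in> U \<and> y \<in> V \<and> disjnt U V"
  proof (cases "proj x = proj y")
    case True
    obtain i where i: "i \<in> I" "proj x \<in> slit_plane i" using proj_in_base[of x] xy by (auto simp: base_def)
    obtain v where v: "v \<in> \<Omega>" "x = sec i v (proj x)" "x \<in> leaf i v" using points_cases[of x i] xy i by auto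
    obtain w where w: "w \<in> \<Omega>" "y = sec i w (proj y)" "y \<in> leaf i w" using points_cases[of y i] xy i True by auto
    have "v \<noteq> w" using v w xy True by metis
    then show ?thesis
      using leaf_disjoint[of i v w] openin_leaf v w i by (metis disjnt_def)
  next
    case False
    then obtain U V where "open U" "open V" "proj x \<in> U" "proj y \<in> V" "U \<inter> V = {}"
      by (meson hausdorff)
    moreover have "openin surface {x \<in> topspace surface. proj x \<in> W}" if "open W" for W
      using openin_continuous_map_preimage[OF continuous_map_proj] that by simp
    ultimately show ?thesis using xy
      by (intro exI[of _ "{x \<in> topspace surface. proj x \<in> U}"] exI[of _ "{x \<in> topspace surface. proj x \<in> V}"])
        (auto simp: disjnt_def)
  qed
qed

section \<open>The Riemann surface and its map to the sphere\<close>

lemma inj_on_proj_leaf: "\<lbrakk>i \<in> I; w \<in> \<Omega>\<rbrakk> \<Longrightarrow> inj_on proj (leaf i w)"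
  by (auto simp: leaf_def inj_on_def)

lemma inv_into_leaf: "\<lbrakk>i \<in> I; w \<in> \<Omega>; x \<in> leaf i w\<rbrakk> \<Longrightarrow> inv_into (leaf i w) proj (proj x) = x"
  using inj_on_proj_leaf by (simp add: inv_into_f_f)

lemma riemann_surface_surface: "riemann_surface surface atlas"
proof
  show "topspace surface \<noteq> {}"
    using sheets i0 sec_in_points off_axis_in_slit_plane[of \<i>] by fastforce
  show "connected_space surface" by (rule connected_space_surface)
  show "Hausdorff_space surface" by (rule Hausdorff_space_surface)
  show "complex_chart surface k" if "k \<in> atlas" for k
    using that by (auto simp: atlas_def complex_chart_def openin_leaf proj_leaf open_slit_plane homeomorphic_map_leaf)
  show "\<Union> (fst ` atlas) = topspace surface"
  proof
    show "\<Union> (fst ` atlas) \<subseteq> topspace surface" by (auto simp: atlas_def) (use leaf_subset in blast)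
    show "topspace surface \<subseteq> \<Union> (fst ` atlas)"
    proof
      fix x assume x: "x \<in> topspace surface"
      then obtain i where i: "i \<in> I" "proj x \<in> slit_plane i" using proj_in_base[of x] by (auto simp: base_def)
      then obtain w where "w \<in> \<Omega>" "x \<in> leaf i w" using points_cases[of x i] x by auto
      then show "x \<in> \<Union> (fst ` atlas)" using i by (force simp: atlas_def)
    qed
  qed
  fix U \<phi> V \<psi> assume "(U, \<phi>) \<in> atlas" "(V, \<psi>) \<in> atlas"
  then have "(\<psi> \<circ> inv_into U \<phi>) z = z" if "z \<in> \<phi> ` (U \<inter> V)" for z
    using that by (auto simp: atlas_def inv_into_leaf)
  then show "(\<psi> \<circ> inv_into U \<phi>) holomorphic_on \<phi> ` (U \<inter> V)"
    by (subst holomorphic_cong[OF refl, of _ _ "\<lambda>z. z"]) (auto intro: holomorphic_on_ident)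
qed

text \<open>
  Every chart is a restriction of the projection, so in charts a map that preserves the projection is
  the identity. For such maps continuity already gives holomorphy.
\<close>

lemma holomorphic_map_fibrewise:
  assumes "continuous_map surface surface f" "\<And>x. x \<in> points \<Longrightarrow> proj (f x) = proj x"
  shows "holomorphic_map surface atlas surface atlas f"
proof -
  have "(proj \<circ> f \<circ> inv_into (leaf i w) proj) holomorphic_on proj ` (leaf i w \<inter> S)"
    if "i \<in> I" "w \<in> \<Omega>" for i w S
  proof -
    have "(proj \<circ> f \<circ> inv_into (leaf i w) proj) z = z" if "z \<in> proj ` (leaf i w \<inter> S)" for z
      using that leaf_subset[OF \<open>i \<in> I\<close> \<open>w \<in> \<Omega>\<close>] \<open>i \<in> I\<close> \<open>w \<in> \<Omega>\<close>
      by (auto simp: inv_into_leaf assms(2) subset_iff)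
    then show ?thesis
      by (subst holomorphic_cong[OF refl, of _ _ "\<lambda>z. z"]) (auto intro: holomorphic_on_ident)
  qed
  then show ?thesis using assms(1) by (auto simp: holomorphic_map_def atlas_def)
qed

lemma meromorphic_map_proj: "meromorphic_map surface atlas (Some \<circ> proj)"
proof -
  have "(\<lambda>z. z) holomorphic_on S" "0 \<notin> S \<Longrightarrow> (\<lambda>z. 1 / z) holomorphic_on S" for S :: "complex set"
    by (auto intro!: holomorphic_intros)
  moreover have "(the \<circ> (Some \<circ> proj) \<circ> inv_into (leaf i w) proj) z = z"
    "((\<lambda>w. case w of None \<Rightarrow> 0 | Some z \<Rightarrow> 1 / z) \<circ> (Some \<circ> proj) \<circ> inv_into (leaf i w) proj) z = 1 / z"
    if "i \<in> I" "w \<in> \<Omega>" "z \<in> proj ` (leaf i w \<inter> S)" for i w z S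
    using that by (auto simp: inv_into_leaf)
  ultimately have "(the \<circ> (Some \<circ> proj) \<circ> inv_into (leaf i w) proj) holomorphic_on proj ` (leaf i w \<inter> S)"
    "0 \<notin> proj ` (leaf i w \<inter> S) \<Longrightarrow> ((\<lambda>w. case w of None \<Rightarrow> 0 | Some z \<Rightarrow> 1 / z) \<circ> (Some \<circ> proj) \<circ> inv_into (leaf i w) proj)
        holomorphic_on proj ` (leaf i w \<inter> S)"
    if "i \<in> I" "w \<in> \<Omega>" for i w S
    using that holomorphic_cong[OF refl, of "proj ` (leaf i w \<inter> S)"] by (metis (no_types, lifting))+
  moreover have "continuous_map surface riemann_sphere (Some \<circ> proj)"
    unfolding riemann_sphere_def by (rule continuous_map_compose[OF continuous_map_proj continuous_map_Some])
  moreover have "0 \<notin> proj ` (S \<inter> (Some \<circ> proj) -` (UNIV - {Some 0}))" for S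
    by auto
  ultimately show ?thesis
    unfolding meromorphic_map_def holomorphic_map_def atlas_def sphere_charts_def by blast
qed

lemma evenly_covered_slit_plane:
  assumes i: "i \<in> I"
  shows "evenly_covered surface riemann_sphere (Some \<circ> proj) (Some ` slit_plane i)"
  unfolding evenly_covered_def
proof (intro conjI exI[of _ "leaf i ` \<Omega>"] ballI)
  show "openin riemann_sphere (Some ` slit_plane i)"
    using open_slit_plane[OF i] by (simp add: riemann_sphere_def)
  show "\<Union> (leaf i ` \<Omega>) = {x \<in> topspace surface. (Some \<circ> proj) x \<in> Some ` slit_plane i}"
  proof
    show "\<Union> (leaf i ` \<Omega>) \<subseteq> {x \<in> topspace surface. (Some \<circ> proj) x \<in> Some ` slit_plane i}"
      using leaf_subset[OF i] proj_leaf[OF i] by fastforce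
    show "{x \<in> topspace surface. (Some \<circ> proj) x \<in> Some ` slit_plane i} \<subseteq> \<Union> (leaf i ` \<Omega>)"
    proof
      fix x assume "x \<in> {x \<in> topspace surface. (Some \<circ> proj) x \<in> Some ` slit_plane i}"
      then have "x \<in> points" "proj x \<in> slit_plane i" by auto
      then show "x \<in> \<Union> (leaf i ` \<Omega>)" using points_cases[OF _ _ i, of x] by blast
    qed
  qed
  show "pairwise disjnt (leaf i ` \<Omega>)"
    using leaf_disjoint[OF i] by (auto simp: pairwise_def disjnt_def)
  fix U assume "U \<in> leaf i ` \<Omega>"
  then obtain w where w: "w \<in> \<Omega>" "U = leaf i w" by auto
  then show "openin surface U" using openin_leaf i by simp
  have "homeomorphic_map (subtopology euclidean (slit_plane i)) (subtopology riemann_sphere (Some ` slit_plane i)) Some"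
    using homeomorphic_map_subtopologies[OF embedding_map_Some[unfolded embedding_map_def, of euclidean], of "slit_plane i" "Some ` slit_plane i"]
    by (auto simp: riemann_sphere_def subtopology_subtopology image_Int[symmetric] Int_absorb1 image_mono)
  then show "homeomorphic_map (subtopology surface U) (subtopology riemann_sphere (Some ` slit_plane i)) (Some \<circ> proj)"
    unfolding w using homeomorphic_map_compose[OF homeomorphic_map_leaf[OF i w(1)]] by blast
qed

lemma branch_values_proj: "branch_values surface riemann_sphere (Some \<circ> proj) \<subseteq> insert None (Some ` (- base))"
proof
  fix y assume y: "y \<in> branch_values surface riemann_sphere (Some \<circ> proj)"
  show "y \<in> insert None (Some ` (- base))"
  proof (cases y)
    case (Some z)
    then have "z \<notin> base" using y evenly_covered_slit_plane by (auto simp: branch_values_def base_def)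
    then show ?thesis using Some by simp
  qed simp
qed

lemma proj_points: "proj ` points = base"
proof
  show "base \<subseteq> proj ` points" using sheets by (force simp: points_def)
qed (use proj_in_base in auto)

lemma compact_base: "compact_space surface \<Longrightarrow> compact base"
  using image_compactin[OF _ continuous_map_proj, of points] proj_points
  by (simp add: compact_space_def)

section \<open>Deck transformations\<close>

text \<open>
  The description operator recovers the sheet of a point. Outside the surface the map is undefined,
  as the group of bijections consists of extensional functions.
\<close>

definition deck :: "('w \<Rightarrow> 'w) \<Rightarrow> 'a \<Rightarrow> 'a" where
  "deck \<sigma> = (\<lambda>x\<in>points. pt (proj x) (\<sigma> (THE w. w \<in> \<Omega> \<and> x = pt (proj x) w)))"

lemma pt_in_points: "\<lbrakk>z \<in> base; w \<in> \<Omega>\<rbrakk> \<Longrightarrow> pt z w \<in> points"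
  by (auto simp: points_def)

lemma deck_pt: "\<lbrakk>z \<in> base; w \<in> \<Omega>\<rbrakk> \<Longrightarrow> deck \<sigma> (pt z w) = pt z (\<sigma> w)"
proof -
  assume *: "z \<in> base" "w \<in> \<Omega>"
  then have "(THE v. v \<in> \<Omega> \<and> pt z w = pt z v) = w" using pt_inject by blast
  then show ?thesis using * by (simp add: deck_def pt_in_points)
qed

lemma points_eqI:
  assumes "f \<in> extensional points" "g \<in> extensional points"
    "\<And>z w. z \<in> base \<Longrightarrow> w \<in> \<Omega> \<Longrightarrow> f (pt z w) = g (pt z w)"
  shows "f = g"
  by (rule extensionalityI[OF assms(1,2)]) (auto simp: points_def assms(3))

lemma deck_extensional: "deck \<sigma> \<in> extensional points"
  by (simp add: deck_def)

lemma deck_continuous: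
  assumes \<sigma>: "\<And>w. w \<in> \<Omega> \<Longrightarrow> \<sigma> w \<in> \<Omega>" "\<And>i w. i \<in> I \<Longrightarrow> w \<in> \<Omega> \<Longrightarrow> \<sigma> (cross i w) = cross i (\<sigma> w)"
  shows "continuous_map surface surface (deck \<sigma>)"
proof -
  have sec: "deck \<sigma> (sec i w z) = sec i (\<sigma> w) z" if "i \<in> I" "w \<in> \<Omega>" "z \<in> slit_plane i" for i w z
    using that slit_plane_subset_base lift_in[OF that(1,2)]
    by (auto simp: sec_def deck_pt subset_iff) (auto simp: lift_def \<sigma>)
  have "openin surface {x \<in> points. deck \<sigma> x \<in> W}" if "openin surface W" for W
  proof -
    have "{z \<in> slit_plane i. sec i w z \<in> points \<and> deck \<sigma> (sec i w z) \<in> W} = {z \<in> slit_plane i. sec i (\<sigma> w) z \<in> W}"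
      if "i \<in> I" "w \<in> \<Omega>" for i w
      using that sec sec_in_points by auto
    then show ?thesis using that \<sigma>(1) by (auto simp: openin_surface)
  qed
  moreover have "deck \<sigma> \<in> points \<rightarrow> points"
    using \<sigma>(1) deck_pt pt_in_points by (auto simp: points_def)
  ultimately show ?thesis by (simp add: continuous_map_def)
qed

lemma deck_cong:
  assumes "\<And>w. w \<in> \<Omega> \<Longrightarrow> \<sigma> w = \<tau> w" shows "deck \<sigma> = deck \<tau>"
  by (rule points_eqI) (auto simp: deck_extensional deck_pt assms)

lemma deck_comp:
  assumes "\<And>w. w \<in> \<Omega> \<Longrightarrow> \<tau> w \<in> \<Omega>"
  shows "compose points (deck \<sigma>) (deck \<tau>) = deck (\<sigma> \<circ> \<tau>)"
  by (rule points_eqI) (auto simp: deck_extensional compose_def pt_in_points deck_pt assms)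

lemma proj_deck:
  assumes "\<And>w. w \<in> \<Omega> \<Longrightarrow> \<sigma> w \<in> \<Omega>" "x \<in> points"
  shows "proj (deck \<sigma> x) = proj x"
  using assms by (auto simp: points_def deck_pt)

lemma deck_in_automorphisms:
  assumes \<sigma>: "bij_betw \<sigma> \<Omega> \<Omega>" "\<And>i w. i \<in> I \<Longrightarrow> w \<in> \<Omega> \<Longrightarrow> \<sigma> (cross i w) = cross i (\<sigma> w)"
  shows "deck \<sigma> \<in> carrier (map_automorphism_group surface atlas (Some \<circ> proj))"
proof -
  define \<tau> where "\<tau> = inv_into \<Omega> \<sigma>"
  have \<sigma>in: "\<sigma> w \<in> \<Omega>" if "w \<in> \<Omega>" for w using \<sigma>(1) that bij_betw_apply by metis
  have \<tau>in: "\<tau> w \<in> \<Omega>" if "w \<in> \<Omega>" for w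
    unfolding \<tau>_def using \<sigma>(1) that by (metis bij_betw_def inv_into_into)
  have \<sigma>\<tau>: "\<sigma> (\<tau> w) = w" "\<tau> (\<sigma> w) = w" if "w \<in> \<Omega>" for w
    unfolding \<tau>_def using \<sigma>(1) that by (metis bij_betw_inv_into_right, metis bij_betw_inv_into_left)
  have \<tau>cross: "\<tau> (cross i w) = cross i (\<tau> w)" if "i \<in> I" "w \<in> \<Omega>" for i w
    using \<sigma>(2)[OF that(1) \<tau>in[OF that(2)]] \<sigma>\<tau> \<tau>in cross_in that by metis
  have inverse: "deck \<sigma> (deck \<tau> x) = x" "deck \<tau> (deck \<sigma> x) = x" "deck \<sigma> x \<in> points" "deck \<tau> x \<in> points"
    if "x \<in> points" for x
    using that by (auto simp: points_def deck_pt \<sigma>\<tau> \<sigma>in \<tau>in) (use \<sigma>in \<tau>in in blast)+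
  have bij: "bij_betw (deck \<sigma>) points points"
    by (rule bij_betw_byWitness[of _ "deck \<tau>"]) (auto simp: inverse)
  have inv: "inv_into points (deck \<sigma>) x = deck \<tau> x" if "x \<in> points" for x
    using bij inverse that by (metis bij_betw_inv_into_left)
  have "continuous_map surface surface (inv_into points (deck \<sigma>))"
    using continuous_map_eq[OF deck_continuous[of \<tau>]] \<tau>in \<tau>cross inv by simp
  then have "holomorphic_map surface atlas surface atlas (inv_into points (deck \<sigma>))"
    using proj_deck[of \<tau>] \<tau>in inv by (intro holomorphic_map_fibrewise) auto
  moreover have "holomorphic_map surface atlas surface atlas (deck \<sigma>)"
    using proj_deck[of \<sigma>] deck_continuous[of \<sigma>] \<sigma>in \<sigma>(2) by (intro holomorphic_map_fibrewise) auto
  ultimately show ?thesis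
    using bij proj_deck[of \<sigma>] \<sigma>in
    by (auto simp: map_automorphism_group_def conformal_automorphisms_def Bij_def deck_extensional)
qed

text \<open>
  The image of a leaf is connected and is covered by the leaves over the same slit plane, which are
  open and pairwise disjoint.
\<close>

lemma leaf_to_leaf:
  assumes f: "continuous_map surface surface f" "\<And>x. x \<in> points \<Longrightarrow> proj (f x) = proj x"
    and i: "i \<in> I" and w: "w \<in> \<Omega>"
  obtains v where "v \<in> \<Omega>" "\<And>z. z \<in> slit_plane i \<Longrightarrow> f (sec i w z) = sec i v z"
proof -
  have fpts: "f (sec i w z) \<in> points" if "z \<in> slit_plane i" for z
    using f(1) sec_in_points[OF i w that] by (auto simp: continuous_map_def)
  have f_proj: "proj (f (sec i w z)) = z" if "z \<in> slit_plane i" for z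
    using f(2) sec_in_points[OF i w that] i w by simp
  have ex: "\<exists>v\<in>\<Omega>. f (sec i w z) = sec i v z" if "z \<in> slit_plane i" for z
    using points_cases[OF fpts[OF that], of i] f_proj[OF that] that i by metis
  have \<i>: "\<i> \<in> slit_plane i" by (simp add: off_axis_in_slit_plane)
  obtain v where v: "v \<in> \<Omega>" "f (sec i w \<i>) = sec i v \<i>" using ex[OF \<i>] by auto
  have "connectedin surface (f ` leaf i w)"
    using connectedin_continuous_map_image[OF f(1) connectedin_leaf[OF i w]] .
  moreover have "f ` leaf i w \<subseteq> leaf i v \<union> \<Union> (leaf i ` (\<Omega> - {v}))"
    using ex by (fastforce simp: leaf_def)
  moreover have "leaf i v \<inter> \<Union> (leaf i ` (\<Omega> - {v})) = {}"
    using leaf_disjoint[OF i v(1)] by blast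
  moreover have "openin surface (leaf i v)" "openin surface (\<Union> (leaf i ` (\<Omega> - {v})))"
    using openin_leaf[OF i] v by auto
  moreover have "leaf i v \<inter> f ` leaf i w \<noteq> {}"
    using v \<i> by (force simp: leaf_def)
  ultimately have "\<Union> (leaf i ` (\<Omega> - {v})) \<inter> f ` leaf i w = {}"
    unfolding connectedin by blast
  then have "f (sec i w z) \<in> leaf i v" if "z \<in> slit_plane i" for z
    using that ex[OF that] unfolding leaf_def by blast
  then have "f (sec i w z) = sec i v z" if "z \<in> slit_plane i" for z
    using that f_proj[OF that] i v(1) unfolding leaf_def by force
  then show ?thesis using that v(1) by blast
qed

text \<open>
  By \<open>leaf_to_leaf\<close> the automorphism moves the sections over \<open>slit_plane i\<close> by some map of sheets. On
  the upper half-plane this map is seen to be the same for all \<open>i\<close>; comparing on the lower half-plane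
  shows that it commutes with the crossings. One point of each half-plane, \<open>\<i>\<close> and \<open>-\<i>\<close>, suffices for
  the comparison.
\<close>

lemma automorphism_is_deck:
  assumes "f \<in> carrier (map_automorphism_group surface atlas (Some \<circ> proj))"
  obtains \<sigma> where "\<And>w. w \<in> \<Omega> \<Longrightarrow> \<sigma> w \<in> \<Omega>"
    "\<And>i w. i \<in> I \<Longrightarrow> w \<in> \<Omega> \<Longrightarrow> \<sigma> (cross i w) = cross i (\<sigma> w)" "f = deck \<sigma>"
proof -
  have cont: "continuous_map surface surface f" and ext: "f \<in> extensional points"
    and fib: "\<And>x. x \<in> points \<Longrightarrow> proj (f x) = proj x"
    using assms by (auto simp: map_automorphism_group_def conformal_automorphisms_def holomorphic_map_def Bij_def)
  have "\<exists>v. v \<in> \<Omega> \<and> (\<forall>z\<in>slit_plane i. f (sec i w z) = sec i v z)" if "i \<in> I" "w \<in> \<Omega>" for i w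
    using leaf_to_leaf[OF cont fib that] by metis
  then obtain s where s: "\<And>i w. i \<in> I \<Longrightarrow> w \<in> \<Omega> \<Longrightarrow> s i w \<in> \<Omega>"
    "\<And>i w z. i \<in> I \<Longrightarrow> w \<in> \<Omega> \<Longrightarrow> z \<in> slit_plane i \<Longrightarrow> f (sec i w z) = sec i (s i w) z"
    by metis
  define \<sigma> where "\<sigma> = s i0"
  have upper: "f (pt \<i> w) = pt \<i> (s i w)" and lower: "f (pt (-\<i>) (cross i w)) = pt (-\<i>) (cross i (s i w))"
    if "i \<in> I" "w \<in> \<Omega>" for i w
    using s(2)[OF that, of \<i>] s(2)[OF that, of "-\<i>"] by (auto simp: off_axis_in_slit_plane sec_def lift_def)
  have s_eq: "s i w = \<sigma> w" if "i \<in> I" "w \<in> \<Omega>" for i w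
    using upper[OF that] upper[OF i0 that(2)] pt_inject s(1) that i0 unfolding \<sigma>_def by metis
  have \<sigma>in: "\<sigma> w \<in> \<Omega>" if "w \<in> \<Omega>" for w using s(1)[OF i0 that] by (simp add: \<sigma>_def)
  have comm: "\<sigma> (cross i w) = cross i (\<sigma> w)" if "i \<in> I" "w \<in> \<Omega>" for i w
    using lower[OF that] lower[OF i0 cross_in[OF that]] pt_inject s_eq cross_i0 cross_in that i0 \<sigma>in by metis
  have "f = deck \<sigma>"
  proof (rule points_eqI[OF ext deck_extensional])
    fix z w assume z: "z \<in> base" and w: "w \<in> \<Omega>"
    obtain i where i: "i \<in> I" "z \<in> slit_plane i" using z by (auto simp: base_def)
    obtain v where v: "v \<in> \<Omega>" "lift i v z = w" using lift_surj[OF i(1) w] .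
    have "f (pt z w) = sec i (\<sigma> v) z" using s(2)[OF i(1) v(1) i(2)] v s_eq[OF i(1) v(1)] by (simp add: sec_def)
    also have "\<dots> = pt z (\<sigma> w)" using comm[OF i(1) v(1)] v by (auto simp: sec_def lift_def)
    finally show "f (pt z w) = deck \<sigma> (pt z w)" using z w by (simp add: deck_pt)
  qed
  then show ?thesis using that \<sigma>in comm by blast
qed

end

section \<open>A permutation representation with prescribed centralizer\<close>

text \<open>
  Transitivity is expressed through invariant predicates, the form in which it is used below.
\<close>

lemma cyclic_permutation_exists:
  assumes "finite K" "K \<noteq> {}"
  obtains c where "bij_betw c K K"
    "\<And>P. \<lbrakk>\<exists>k\<in>K. P k; \<And>k. k \<in> K \<Longrightarrow> P (c k) \<longleftrightarrow> P k\<rbrakk> \<Longrightarrow> \<forall>k\<in>K. P k"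
proof -
  define n where "n = card K"
  have n: "n > 0" using assms by (simp add: n_def card_gt_0_iff)
  obtain h where h: "bij_betw h {0..<n} K"
    using ex_bij_betw_nat_finite[OF assms(1)] n_def by blast
  define r where "r = (\<lambda>m. Suc m mod n)"
  have "r ` {0..<n} = {0..<n}"
  proof
    show "r ` {0..<n} \<subseteq> {0..<n}" using n by (auto simp: r_def)
    show "{0..<n} \<subseteq> r ` {0..<n}"
    proof
      fix m assume "m \<in> {0..<n}"
      then have "m = r (if m = 0 then n - 1 else m - 1)" "(if m = 0 then n - 1 else m - 1) \<in> {0..<n}"
        using n by (auto simp: r_def)
      then show "m \<in> r ` {0..<n}" by blast
    qed
  qed
  then have r: "bij_betw r {0..<n} {0..<n}"
    by (simp add: bij_betw_def eq_card_imp_inj_on)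
  define c where "c = h \<circ> r \<circ> inv_into {0..<n} h"
  have "bij_betw c K K"
    unfolding c_def using bij_betw_trans bij_betw_inv_into h r by metis
  moreover have "\<forall>k\<in>K. P k" if ex: "\<exists>k\<in>K. P k" and inv: "\<And>k. k \<in> K \<Longrightarrow> P (c k) \<longleftrightarrow> P k" for P
  proof -
    have step: "P (h (Suc m)) \<longleftrightarrow> P (h m)" if "Suc m < n" for m
    proof -
      have "c (h m) = h (Suc m)"
        using that h by (simp add: c_def r_def bij_betw_inv_into_left)
      moreover have "h m \<in> K" using that h by (auto simp: bij_betw_def)
      ultimately show ?thesis using inv by metis
    qed
    have all: "P (h m) \<longleftrightarrow> P (h 0)" if "m < n" for m
      using that by (induction m) (auto simp: step)
    then show ?thesis using ex h
      by (metis atLeastLessThan_iff bij_betw_iff_bijections)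
  qed
  ultimately show ?thesis using that by blast
qed

text \<open>
  The generated set is exhausted by the sets \<open>T n\<close> of products of at most \<open>2 ^ n\<close> factors.
\<close>

lemma countable_generate:
  assumes "countable A" shows "countable (generate G A)"
proof -
  define T where "T = rec_nat ({\<one>\<^bsub>G\<^esub>} \<union> A \<union> m_inv G ` A) (\<lambda>_ S. S \<union> (\<lambda>(x, y). x \<otimes>\<^bsub>G\<^esub> y) ` (S \<times> S))"
  have T0: "T 0 = {\<one>\<^bsub>G\<^esub>} \<union> A \<union> m_inv G ` A"
    and TSuc: "T (Suc n) = T n \<union> (\<lambda>(x, y). x \<otimes>\<^bsub>G\<^esub> y) ` (T n \<times> T n)" for n
    by (simp_all add: T_def)
  have "countable (T n)" for n
    by (induction n) (auto simp: T0 TSuc assms)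
  moreover have "generate G A \<subseteq> (\<Union>n. T n)"
  proof
    fix g assume "g \<in> generate G A"
    then show "g \<in> (\<Union>n. T n)"
    proof induction
      case (eng h1 h2)
      then obtain m n where mn: "h1 \<in> T m" "h2 \<in> T n" by auto
      have "mono T" by (rule mono_iff_le_Suc[THEN iffD2]) (auto simp: TSuc)
      then have "T m \<subseteq> T (max m n)" "T n \<subseteq> T (max m n)" by (meson monoD max.cobounded1 max.cobounded2)+
      then have "h1 \<otimes>\<^bsub>G\<^esub> h2 \<in> T (Suc (max m n))" using mn by (auto simp: TSuc)
      then show ?case by blast
    qed (use T0 in \<open>blast+\<close>)
  qed
  ultimately show ?thesis by (meson countable_UN countable_subset UNIV_I countableI_type)
qed

definition translate :: "('g, 'r) monoid_scheme \<Rightarrow> 'g \<Rightarrow> 'g \<times> 'k \<Rightarrow> 'g \<times> 'k" where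
  "translate G g = (\<lambda>(h, k). (g \<otimes>\<^bsub>G\<^esub> h, k))"

lemma (in group) bij_betw_translate:
  assumes "g \<in> carrier G" shows "bij_betw (translate G g) (carrier G \<times> K) (carrier G \<times> K)"
  by (rule bij_betw_byWitness[of _ "translate G (inv g)"])
    (use assms in \<open>auto simp: translate_def m_assoc[symmetric]\<close>)

text \<open>
  The elements of \<open>insert \<one> A\<close> serve both as a set that \<open>a\<close> permutes cyclically and as right multipliers
  for \<open>b\<close>. Moving from \<open>(g, 1)\<close> to \<open>(g, k)\<close> by powers of \<open>a\<close>, applying \<open>b\<close> and moving back gives \<open>(g k, 1)\<close>;
  as \<open>A\<close> generates the group, the action is transitive. The element \<open>1\<close> of \<open>insert \<one> A\<close> is the only
  one with trivial right multiplication; it marks the orbit of \<open>(1, 1)\<close> under left translations, and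
  this excludes further commuting maps.
\<close>

lemma (in group) permutations_with_centralizer:
  assumes A: "finite A" "A \<subseteq> carrier G" "generate G A = carrier G"
  defines "\<Omega> \<equiv> carrier G \<times> insert \<one> A"
  shows "\<exists>a b. bij_betw a \<Omega> \<Omega> \<and> bij_betw b \<Omega> \<Omega> \<and>
    (\<forall>P\<subseteq>\<Omega>. P \<noteq> {} \<longrightarrow> (\<forall>w\<in>\<Omega>. (a w \<in> P \<longleftrightarrow> w \<in> P) \<and> (b w \<in> P \<longleftrightarrow> w \<in> P)) \<longrightarrow> P = \<Omega>) \<and>
    (\<forall>g\<in>carrier G. \<forall>w\<in>\<Omega>. translate G g (a w) = a (translate G g w) \<and> translate G g (b w) = b (translate G g w)) \<and>
    (\<forall>\<sigma>\<in>\<Omega> \<rightarrow> \<Omega>. (\<forall>w\<in>\<Omega>. \<sigma> (a w) = a (\<sigma> w) \<and> \<sigma> (b w) = b (\<sigma> w)) \<longrightarrow>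
       (\<exists>g\<in>carrier G. \<forall>w\<in>\<Omega>. \<sigma> w = translate G g w))"
proof -
  let ?K = "insert \<one> A"
  have K: "k \<in> carrier G" if "k \<in> ?K" for k using that A(2) by auto
  obtain c where c: "bij_betw c ?K ?K"
    and c_trans: "\<And>P. \<lbrakk>\<exists>k\<in>?K. P k; \<And>k. k \<in> ?K \<Longrightarrow> P (c k) \<longleftrightarrow> P k\<rbrakk> \<Longrightarrow> \<forall>k\<in>?K. P k"
    using cyclic_permutation_exists[of ?K] A(1) by blast
  define a :: "'a \<times> 'a \<Rightarrow> 'a \<times> 'a" where "a = (\<lambda>(g, k). (g, c k))"
  define b :: "'a \<times> 'a \<Rightarrow> 'a \<times> 'a" where "b = (\<lambda>(g, k). (g \<otimes> k, k))"
  have cK: "c k \<in> ?K" if "k \<in> ?K" for k using c that bij_betw_apply by metis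
  have a: "bij_betw a \<Omega> \<Omega>"
    unfolding a_def \<Omega>_def using bij_betw_map_prod[OF bij_betw_id c] by (simp add: map_prod_def id_def)
  have b: "bij_betw b \<Omega> \<Omega>"
    by (rule bij_betw_byWitness[of _ "\<lambda>(g, k). (g \<otimes> inv k, k)"])
      (auto simp: b_def \<Omega>_def m_assoc K)
  have trans: "P = \<Omega>"
    if P: "P \<subseteq> \<Omega>" "P \<noteq> {}" and aP: "\<And>w. w \<in> \<Omega> \<Longrightarrow> a w \<in> P \<longleftrightarrow> w \<in> P" and bP: "\<And>w. w \<in> \<Omega> \<Longrightarrow> b w \<in> P \<longleftrightarrow> w \<in> P" for P
  proof -
    have row: "(g, k) \<in> P \<longleftrightarrow> (g, \<one>) \<in> P" if g: "g \<in> carrier G" and k: "k \<in> ?K" for g k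
    proof -
      have inv: "(g, c k) \<in> P \<longleftrightarrow> (g, k) \<in> P" if "k \<in> ?K" for k
        using aP[of "(g, k)"] g that by (simp add: \<Omega>_def a_def)
      have "\<forall>k\<in>?K. (g, k) \<in> P" if "\<exists>k\<in>?K. (g, k) \<in> P"
        using c_trans[of "\<lambda>k. (g, k) \<in> P"] inv that by blast
      then show ?thesis using k by blast
    qed
    have gen: "(g \<otimes> k, \<one>) \<in> P \<longleftrightarrow> (g, \<one>) \<in> P" if g: "g \<in> carrier G" and k: "k \<in> A" for g k
      using bP[of "(g, k)"] row[of g k] row[of "g \<otimes> k" k] g k K by (auto simp: \<Omega>_def b_def)
    have gens: "\<forall>g\<in>carrier G. (g \<otimes> h, \<one>) \<in> P \<longleftrightarrow> (g, \<one>) \<in> P" if "h \<in> generate G A" for h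
      using that
    proof induction
      case (incl h)
      then show ?case using gen by blast
    next
      case (inv h)
      then have h: "h \<in> carrier G" using A(2) by blast
      show ?case
      proof
        fix g assume "g \<in> carrier G"
        then show "(g \<otimes> inv h, \<one>) \<in> P \<longleftrightarrow> (g, \<one>) \<in> P"
          using gen[of "g \<otimes> inv h" h] inv h by (simp add: m_assoc)
      qed
    next
      case (eng h1 h2)
      then have "h1 \<in> carrier G" "h2 \<in> carrier G" using A(3) by auto
      then show ?case using eng by (simp add: m_assoc[symmetric])
    qed simp
    have all: "(g, k) \<in> P \<longleftrightarrow> (\<one>, \<one>) \<in> P" if "(g, k) \<in> \<Omega>" for g k
    proof -
      have gk: "g \<in> carrier G" "k \<in> ?K" using that by (auto simp: \<Omega>_def)
      then have "(\<one> \<otimes> g, \<one>) \<in> P \<longleftrightarrow> (\<one>, \<one>) \<in> P" using gens[of g] A(3) by blast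
      then show ?thesis using row[OF gk] gk by simp
    qed
    obtain g k where "(g, k) \<in> P" using P(2) by auto
    then have "(\<one>, \<one>) \<in> P" using all[of g k] P(1) by blast
    then show ?thesis using all P(1) by auto
  qed
  have La: "translate G g (a w) = a (translate G g w)" and Lb: "translate G g (b w) = b (translate G g w)"
    if "g \<in> carrier G" "w \<in> \<Omega>" for g w
    using that K by (auto simp: translate_def a_def b_def \<Omega>_def m_assoc)
  have centr: "\<exists>g\<in>carrier G. \<forall>w\<in>\<Omega>. \<sigma> w = translate G g w"
    if \<sigma>: "\<And>w. w \<in> \<Omega> \<Longrightarrow> \<sigma> w \<in> \<Omega>" and \<sigma>a: "\<And>w. w \<in> \<Omega> \<Longrightarrow> \<sigma> (a w) = a (\<sigma> w)" and \<sigma>b: "\<And>w. w \<in> \<Omega> \<Longrightarrow> \<sigma> (b w) = b (\<sigma> w)" for \<sigma>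
  proof -
    have o: "(\<one>, \<one>) \<in> \<Omega>" by (simp add: \<Omega>_def)
    obtain g k where gk: "\<sigma> (\<one>, \<one>) = (g, k)" by fastforce
    then have g: "g \<in> carrier G" and k: "k \<in> ?K" using \<sigma>[OF o] by (auto simp: \<Omega>_def)
    \<comment> \<open>\<open>b\<close> fixes \<open>(\<one>, \<one>)\<close>, hence also its image under \<open>\<sigma>\<close>.\<close>
    have "b (g, k) = (g, k)" using \<sigma>b[OF o] gk by (simp add: b_def)
    then have "k = \<one>" using g K[OF k] by (simp add: b_def)
    define P where "P = {w \<in> \<Omega>. \<sigma> w = translate G g w}"
    have L: "translate G g w \<in> \<Omega>" if "w \<in> \<Omega>" for w
      using bij_betw_translate[OF g, of ?K] that unfolding \<Omega>_def by (meson bij_betw_apply)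
    have step: "d w \<in> P \<longleftrightarrow> w \<in> P"
      if "bij_betw d \<Omega> \<Omega>" "\<And>w. w \<in> \<Omega> \<Longrightarrow> \<sigma> (d w) = d (\<sigma> w)" "\<And>w. w \<in> \<Omega> \<Longrightarrow> translate G g (d w) = d (translate G g w)" "w \<in> \<Omega>" for d w
    proof -
      have "d w \<in> \<Omega>" using that by (meson bij_betw_apply)
      moreover have "d (\<sigma> w) = d (translate G g w) \<longleftrightarrow> \<sigma> w = translate G g w"
        by (rule inj_on_eq_iff[OF bij_betw_imp_inj_on[OF that(1)] \<sigma>[OF that(4)] L[OF that(4)]])
      ultimately show ?thesis using that by (simp add: P_def)
    qed
    have "(\<one>, \<one>) \<in> P" using o gk \<open>k = \<one>\<close> g by (simp add: P_def translate_def)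
    then have "P = \<Omega>"
      using step[OF a \<sigma>a La[OF g]] step[OF b \<sigma>b Lb[OF g]] by (intro trans) (auto simp: P_def)
    then show ?thesis using g by (auto simp: P_def)
  qed
  show ?thesis
  proof (intro exI conjI ballI allI impI)
    show "P = \<Omega>" if "P \<subseteq> \<Omega>" "P \<noteq> {}" "\<forall>w\<in>\<Omega>. (a w \<in> P \<longleftrightarrow> w \<in> P) \<and> (b w \<in> P \<longleftrightarrow> w \<in> P)" for P
      using trans[of P] that by simp
    show "\<exists>g\<in>carrier G. \<forall>w\<in>\<Omega>. \<sigma> w = translate G g w"
      if "\<sigma> \<in> \<Omega> \<rightarrow> \<Omega>" "\<forall>w\<in>\<Omega>. \<sigma> (a w) = a (\<sigma> w) \<and> \<sigma> (b w) = b (\<sigma> w)" for \<sigma>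
      using centr[of \<sigma>] that by (simp add: Pi_iff)
  qed (fact a b La Lb)+
qed

text \<open>
  This lets a surface with countably many sheets be modelled on a set of complex numbers.
\<close>

lemma countable_copies_of_plane_inject:
  assumes "countable \<Omega>"
  shows "\<exists>e :: complex \<times> 'w \<Rightarrow> complex. inj_on e (UNIV \<times> \<Omega>)"
proof
  \<comment> \<open>The plane is squeezed into a vertical strip of width less than \<open>1\<close>, and copy \<open>n\<close> is shifted by \<open>n\<close>.\<close>
  let ?n = "to_nat_on \<Omega>"
  let ?e = "\<lambda>p. Complex (arctan (Re (fst p)) / 4 + real (?n (snd p))) (Im (fst p))"
  show "inj_on ?e (UNIV \<times> \<Omega>)"
  proof (rule inj_onI)
    fix p q assume pq: "p \<in> UNIV \<times> \<Omega>" "q \<in> UNIV \<times> \<Omega>" and eq: "?e p = ?e q"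
    have bound: "\<bar>arctan x / 4\<bar> < 1 / 2" for x
      using arctan_lbound[of x] arctan_ubound[of x] pi_less_4 by auto
    have "arctan (Re (fst p)) / 4 + real (?n (snd p)) = arctan (Re (fst q)) / 4 + real (?n (snd q))"
      using eq by simp
    then have "\<bar>real (?n (snd p)) - real (?n (snd q))\<bar> < 1"
      using bound[of "Re (fst p)"] bound[of "Re (fst q)"] by linarith
    then have n: "?n (snd p) = ?n (snd q)" by linarith
    then have "snd p = snd q"
      using pq by (intro inj_onD[OF inj_on_to_nat_on[OF assms]]) auto
    moreover have "fst p = fst q"
      using eq n by (simp add: complex_eq_iff arctan_eq_iff)
    ultimately show "p = q" by (simp add: prod_eq_iff)
  qed
qed

section \<open>Realizing a finitely generated group\<close>

theorem theorem5:
  fixes G :: "('g, 'r) monoid_scheme"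
  assumes "finitely_generated_group G"
  shows "\<exists>(X :: complex topology) \<A> \<beta>.
           riemann_surface X \<A> \<and>
           (infinite (carrier G) \<longrightarrow> \<not> compact_space X) \<and>
           meromorphic_map X \<A> \<beta> \<and>
           \<not> \<beta> constant_on topspace X \<and>
           finite (branch_values X riemann_sphere \<beta>) \<and>
           card (branch_values X riemann_sphere \<beta>) \<le> 3 \<and>
           G \<cong> map_automorphism_group X \<A> \<beta>"
proof -
  obtain A where "group G" and A: "finite A" "A \<subseteq> carrier G" "generate G A = carrier G"
    using assms unfolding finitely_generated_group_def by blast
  interpret group G by fact
  define \<Omega> where "\<Omega> = carrier G \<times> insert \<one>\<^bsub>G\<^esub> A"
  obtain a b where a: "bij_betw a \<Omega> \<Omega>" and b: "bij_betw b \<Omega> \<Omega>"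
    and trans: "\<forall>P\<subseteq>\<Omega>. P \<noteq> {} \<longrightarrow> (\<forall>w\<in>\<Omega>. (a w \<in> P \<longleftrightarrow> w \<in> P) \<and> (b w \<in> P \<longleftrightarrow> w \<in> P)) \<longrightarrow> P = \<Omega>"
    and L: "\<forall>g\<in>carrier G. \<forall>w\<in>\<Omega>. translate G g (a w) = a (translate G g w) \<and> translate G g (b w) = b (translate G g w)"
    and centralizer: "\<forall>\<sigma>\<in>\<Omega> \<rightarrow> \<Omega>. (\<forall>w\<in>\<Omega>. \<sigma> (a w) = a (\<sigma> w) \<and> \<sigma> (b w) = b (\<sigma> w)) \<longrightarrow>
       (\<exists>g\<in>carrier G. \<forall>w\<in>\<Omega>. \<sigma> w = translate G g w)"
    using permutations_with_centralizer[OF A] unfolding \<Omega>_def by blast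
  have "countable \<Omega>"
    using countable_generate[of A G] A by (simp add: \<Omega>_def countable_finite)
  then obtain e :: "complex \<times> 'g \<times> 'g \<Rightarrow> complex" where e: "inj_on e (UNIV \<times> \<Omega>)"
    using countable_copies_of_plane_inject by blast
  define pt where "pt z w = e (z, w)" for z w
  have pt: "z = z' \<and> w = w'" if "w \<in> \<Omega>" "w' \<in> \<Omega>" "pt z w = pt z' w'" for z w z' w'
    using inj_onD[OF e, of "(z, w)" "(z', w')"] that by (simp add: pt_def)
  define gap :: "int \<Rightarrow> real set" where
    "gap i = (if i = 0 then {0<..<1} else if i = 1 then {..<0} else {1<..})" for i
  define cross where "cross i = (if i = 0 then id else if i = 1 then a else b)" for i :: int
  interpret slit_gluing "{0, 1, 2}" 0 gap \<Omega> cross pt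
  proof
    show "P = \<Omega>" if "P \<subseteq> \<Omega>" "P \<noteq> {}" "\<And>i w. i \<in> {0, 1, 2} \<Longrightarrow> w \<in> \<Omega> \<Longrightarrow> cross i w \<in> P \<longleftrightarrow> w \<in> P" for P
      using trans[rule_format, of P] that(1,2) that(3)[of 1] that(3)[of 2] by (simp add: cross_def)
    show "i = j" if "i \<in> {0, 1, 2}" "j \<in> {0, 1, 2}" "t \<in> gap i" "t \<in> gap j" for i j t
      using that by (auto simp: gap_def split: if_splits)
    show "gap i \<noteq> {}" for i
      using dense[of "0::real" 1] by (auto simp: gap_def)
    show "\<Omega> \<noteq> {}" by (auto simp: \<Omega>_def)
    show "z = z' \<and> w = w'" if "w \<in> \<Omega>" "w' \<in> \<Omega>" "pt z w = pt z' w'" for z w z' w'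
      using pt that by blast
  qed (auto simp: gap_def cross_def a b)
  let ?\<beta> = "Some \<circ> proj"
  let ?Aut = "map_automorphism_group surface atlas ?\<beta>"
  have base: "base = - {0, 1}"
  proof -
    have "z \<in> base \<longleftrightarrow> z \<noteq> 0 \<and> z \<noteq> 1" for z
      by (auto simp: base_def slit_plane_def gap_def complex_eq_iff)
    then show ?thesis by auto
  qed
  have branch: "branch_values surface riemann_sphere ?\<beta> \<subseteq> {None, Some 0, Some 1}"
    using branch_values_proj by (simp add: base)
  have "card {None, Some 0, Some (1::complex)} \<le> 3"
    by (simp add: card_insert_if)
  then have card: "card (branch_values surface riemann_sphere ?\<beta>) \<le> 3"
    using card_mono[OF _ branch] by simp
  have noncompact: "\<not> compact_space surface"
  proof
    assume "compact_space surface"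
    then have "bounded base" using compact_base compact_imp_bounded by blast
    then have "bounded (base \<union> {0, 1})" by simp
    moreover have "base \<union> {0, 1} = UNIV" by (auto simp: base)
    ultimately show False using not_bounded_UNIV[where 'a = complex] by metis
  qed
  have nonconst: "\<not> ?\<beta> constant_on topspace surface"
  proof
    assume "?\<beta> constant_on topspace surface"
    then obtain y where "\<forall>z\<in>proj ` points. Some z = y" by (auto simp: constant_on_def)
    moreover have "\<i> \<in> base" "-\<i> \<in> base" by (auto simp: base complex_eq_iff)
    ultimately have "Some \<i> = Some (-\<i>)" using proj_points by metis
    then show False by (simp add: complex_eq_iff)
  qed
  have \<i>: "\<i> \<in> base" by (simp add: base)
  define h where "h g = deck (translate G g)" for g
  have translate_in: "translate G g w \<in> \<Omega>" if "g \<in> carrier G" "w \<in> \<Omega>" for g w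
    using that by (auto simp: translate_def \<Omega>_def)
  have h_in: "h g \<in> carrier ?Aut" if "g \<in> carrier G" for g
    unfolding h_def
  proof (rule deck_in_automorphisms)
    show "bij_betw (translate G g) \<Omega> \<Omega>" unfolding \<Omega>_def by (rule bij_betw_translate[OF that])
    show "translate G g (cross i w) = cross i (translate G g w)" if "i \<in> {0, 1, 2}" "w \<in> \<Omega>" for i w
      using L \<open>g \<in> carrier G\<close> that by (auto simp: cross_def)
  qed
  have "h \<in> hom G ?Aut"
  proof (rule homI)
    fix g g' assume g: "g \<in> carrier G" "g' \<in> carrier G"
    have Bij: "h x \<in> Bij points" if "x \<in> carrier G" for x
      using h_in[OF that] by (simp add: map_automorphism_group_def conformal_automorphisms_def)
    have "h g \<otimes>\<^bsub>?Aut\<^esub> h g' = compose points (h g) (h g')"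
      using Bij g by (simp add: map_automorphism_group_def BijGroup_def)
    also have "\<dots> = deck (translate G g \<circ> translate G g')"
      unfolding h_def using translate_in g by (intro deck_comp)
    also have "\<dots> = h (g \<otimes>\<^bsub>G\<^esub> g')"
      unfolding h_def using g by (intro deck_cong) (auto simp: translate_def \<Omega>_def m_assoc)
    finally show "h (g \<otimes>\<^bsub>G\<^esub> g') = h g \<otimes>\<^bsub>?Aut\<^esub> h g'" by simp
  qed (rule h_in)
  moreover have "bij_betw h (carrier G) (carrier ?Aut)"
  proof (rule bij_betw_imageI)
    show "inj_on h (carrier G)"
    proof (rule inj_onI)
      fix g g' assume g: "g \<in> carrier G" "g' \<in> carrier G" "h g = h g'"
      have o: "(\<one>\<^bsub>G\<^esub>, \<one>\<^bsub>G\<^esub>) \<in> \<Omega>" by (simp add: \<Omega>_def)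
      have "pt \<i> (translate G g (\<one>\<^bsub>G\<^esub>, \<one>\<^bsub>G\<^esub>)) = pt \<i> (translate G g' (\<one>\<^bsub>G\<^esub>, \<one>\<^bsub>G\<^esub>))"
        using fun_cong[OF g(3), of "pt \<i> (\<one>\<^bsub>G\<^esub>, \<one>\<^bsub>G\<^esub>)"] deck_pt[OF \<i> o] by (simp add: h_def)
      then have "translate G g (\<one>\<^bsub>G\<^esub>, \<one>\<^bsub>G\<^esub>) = translate G g' (\<one>\<^bsub>G\<^esub>, \<one>\<^bsub>G\<^esub>)"
        using pt translate_in o g by blast
      then show "g = g'" using g by (simp add: translate_def)
    qed
    show "h ` carrier G = carrier ?Aut"
    proof
      show "h ` carrier G \<subseteq> carrier ?Aut" using h_in by blast
      show "carrier ?Aut \<subseteq> h ` carrier G"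
      proof
        fix f assume "f \<in> carrier ?Aut"
        then obtain \<sigma> where \<sigma>: "\<And>w. w \<in> \<Omega> \<Longrightarrow> \<sigma> w \<in> \<Omega>"
          "\<And>i w. i \<in> {0, 1, 2} \<Longrightarrow> w \<in> \<Omega> \<Longrightarrow> \<sigma> (cross i w) = cross i (\<sigma> w)" "f = deck \<sigma>"
          using automorphism_is_deck by metis
        have "\<sigma> (a w) = a (\<sigma> w)" "\<sigma> (b w) = b (\<sigma> w)" if "w \<in> \<Omega>" for w
          using \<sigma>(2)[of 1 w] \<sigma>(2)[of 2 w] that by (simp_all add: cross_def)
        then obtain g where g: "g \<in> carrier G" "\<forall>w\<in>\<Omega>. \<sigma> w = translate G g w"
          using bspec[OF centralizer, of \<sigma>] \<sigma>(1) by blast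
        then have "f = h g" unfolding h_def \<sigma>(3) by (intro deck_cong) auto
        then show "f \<in> h ` carrier G" using g(1) by blast
      qed
    qed
  qed
  ultimately have "G \<cong> ?Aut" by (auto simp: is_iso_def iso_def)
  moreover have "finite (branch_values surface riemann_sphere ?\<beta>)"
    using branch by (rule finite_subset) simp
  ultimately show ?thesis
    using riemann_surface_surface noncompact meromorphic_map_proj nonconst card by blast
qed

end
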